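(* Let $n, k$ be positive integers such that $n/2 \le k \le n-1$. Then $K_{n}^{\le k}$ is $1$-factorable if and only if $K_n^{\le n-k-1}$ is $1$-factorable.
   Context: A hypergraph $H=(V,E)$ consists of a vertex set $V$ and an edge set $E$ which is a family of non-empty subsets of $V$. A $1$-factor of $H$ is a spanning sub-hypergraph in which every vertex is contained in exactly one edge (i.e. a set of pairwise disjoint edges whose union is $V$). $H$ is $1$-factorable if its edge set $E$ can be partitioned into (edge sets of) $1$-factors; if $E$ is empty this holds vacuously (partition into zero $1$-factors). For an integer $m\ge 0$, $K_n^{\le m}$ denotes the hypergraph with vertex set $[n]=\{1,\dots,n\}$ whose edges are all non-empty subsets of $[n]$ of size at most $m$; in particular $K_n^{\le 0}$ has no edges. *)

theory Defs
  imports Complex_Main "HOL-Library.Disjoint_Sets"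
begin

text \<open>A hypergraph is a pair of a vertex set and an edge set.\<close>

type_synonym 'a hypergraph = "'a set \<times> 'a set set"

abbreviation verts :: "'a hypergraph \<Rightarrow> 'a set" where
  "verts H \<equiv> fst H"

abbreviation edges :: "'a hypergraph \<Rightarrow> 'a set set" where
  "edges H \<equiv> snd H"

definition hypergraph :: "'a hypergraph \<Rightarrow> bool" where
  "hypergraph H \<longleftrightarrow> (\<forall>e\<in>edges H. e \<noteq> {} \<and> e \<subseteq> verts H)"

text \<open>A 1-factor is a spanning sub-hypergraph, so it is determined by, and here
  identified with, its edge set.\<close>

definition one_factor :: "'a hypergraph \<Rightarrow> 'a set set \<Rightarrow> bool" where
  "one_factor H F \<longleftrightarrow> F \<subseteq> edges H \<and> (\<forall>v\<in>verts H. \<exists>!e. e \<in> F \<and> v \<in> e)"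

text \<open>If \<open>H\<close> has no edges, the empty partition witnesses 1-factorability.\<close>

definition one_factorable :: "'a hypergraph \<Rightarrow> bool" where
  "one_factorable H \<longleftrightarrow>
     hypergraph H \<and> (\<exists>P. partition_on (edges H) P \<and> (\<forall>F\<in>P. one_factor H F))"

definition complete_upto :: "nat \<Rightarrow> nat \<Rightarrow> nat hypergraph" where
  "complete_upto n m = ({1..n}, {e. e \<subseteq> {1..n} \<and> e \<noteq> {} \<and> card e \<le> m})"

lemma hypergraph_complete_upto: "hypergraph (complete_upto n m)"
  by (simp add: hypergraph_def complete_upto_def)

lemma one_factor_iff_partition_on:
  assumes "hypergraph H"
  shows "one_factor H F \<longleftrightarrow> F \<subseteq> edges H \<and> partition_on (verts H) F"
proof (intro iffI conjI)
  assume F: "one_factor H F"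
  then show sub: "F \<subseteq> edges H" by (simp add: one_factor_def)
  have uniq: "\<exists>!e. e \<in> F \<and> v \<in> e" if "v \<in> verts H" for v
    using F that by (simp add: one_factor_def)
  have edge: "e \<noteq> {} \<and> e \<subseteq> verts H" if "e \<in> F" for e
    using sub that assms by (auto simp: hypergraph_def)
  show "partition_on (verts H) F"
  proof (rule partition_onI)
    show "\<Union>F = verts H"
    proof
      show "\<Union>F \<subseteq> verts H" using edge by (meson Union_least)
      show "verts H \<subseteq> \<Union>F" using uniq by (meson UnionI subsetI)
    qed
    show "{} \<notin> F" using edge by auto
  next
    fix p q assume pq: "p \<in> F" "q \<in> F" "p \<noteq> q"
    show "disjnt p q"
    proof (rule ccontr)
      assume "\<not> disjnt p q"
      then obtain v where v: "v \<in> p" "v \<in> q" by (auto simp: disjnt_iff)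
      then have "v \<in> verts H" using edge pq by (meson subsetD)
      then show False using uniq pq v by metis
    qed
  qed
next
  assume F: "F \<subseteq> edges H \<and> partition_on (verts H) F"
  have "\<exists>!e. e \<in> F \<and> v \<in> e" if v: "v \<in> verts H" for v
  proof -
    obtain e where "e \<in> F" "v \<in> e"
      using F v by (metis UnionE partition_onD1)
    moreover have "e' = e" if "e' \<in> F" "v \<in> e'" for e'
      using F that calculation by (metis disjointD disjoint_iff partition_onD2)
    ultimately show ?thesis by blast
  qed
  then show "one_factor H F" using F by (simp add: one_factor_def)
qed

end

theory Submission
  imports Defs
begin

text \<open>
  The two hypergraphs differ by the sets whose size lies between \<open>n - k\<close> and \<open>k\<close>. This range of
  sizes is invariant under complementation, so these sets come in complementary pairs
  \<open>{S, V - S}\<close>, and each such pair is itself a 1-factor. Hence a 1-factorization of the smaller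
  hypergraph extends to one of the larger.

  For the converse, a 1-factorization of the larger hypergraph can be made to contain every such
  pair, by exchanges. Suppose that \<open>S\<close> and its complement \<open>T\<close> lie in different 1-factors
  \<open>{S} \<union> A\<close> and \<open>{T} \<union> B\<close>. Then \<open>A\<close> partitions \<open>T\<close> and \<open>B\<close> partitions \<open>S\<close>, so the same edges
  can be regrouped into the 1-factors \<open>{S, T}\<close> and \<open>A \<union> B\<close>. Thus adding or deleting one
  complementary pair never affects 1-factorability (\<open>one_factorable_insert_complementary_pair\<close>),
  and the theorem follows by induction on the set of edges to be deleted
  (\<open>one_factorable_Un_complement_closed\<close>).
\<close>

lemma one_factorable_iff_partition_on:
  "one_factorable (V, E) \<longleftrightarrow>
     hypergraph (V, E) \<and> (\<exists>P. partition_on E P \<and> (\<forall>F\<in>P. partition_on V F))"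
proof -
  have "one_factor (V, E) F \<longleftrightarrow> partition_on V F"
    if "hypergraph (V, E)" "partition_on E P" "F \<in> P" for P F
    using that by (auto simp: one_factor_iff_partition_on dest: partition_onD1)
  then show ?thesis by (auto simp: one_factorable_def)
qed

lemma partition_on_remove_part:
  assumes "partition_on A P" "p \<in> P"
  shows "partition_on (A - p) (P - {p})"
proof -
  have "disjnt p (\<Union>(P - {p}))"
    using assms by (auto simp: partition_on_def disjoint_def disjnt_def)
  then show ?thesis
    using partition_on_insert[of p "P - {p}" A] assms by (simp add: insert_absorb)
qed

text \<open>
  If \<open>S\<close> and \<open>V - S\<close> form a 1-factor of the given factorization, it is simply dropped. Otherwise
  what remains of their two 1-factors is a partition of \<open>V - S\<close> and a partition of \<open>S\<close>, and these
  merge into a single 1-factor; the other 1-factors are left alone.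
\<close>

lemma one_factorable_remove_complementary_pair:
  assumes fac: "one_factorable (V, E)" and S: "S \<in> E" and T: "V - S \<in> E"
  shows "one_factorable (V, E - {S, V - S})"
proof -
  define T where "T = V - S"
  obtain P where P: "partition_on E P" and fct: "\<And>F. F \<in> P \<Longrightarrow> partition_on V F"
    and hyp: "hypergraph (V, E)"
    using fac by (auto simp: one_factorable_iff_partition_on)
  have ST: "S \<subseteq> V" "S \<noteq> {}" "T \<noteq> {}" "T \<in> E" "V - T = S"
    using hyp S T by (auto simp: hypergraph_def T_def)
  obtain P1 where P1: "P1 \<in> P" "S \<in> P1" using P S by (auto simp: partition_on_def)
  obtain P2 where P2: "P2 \<in> P" "T \<in> P2" using P ST by (auto simp: partition_on_def)
  define A where "A = P1 - {S}"
  define B where "B = P2 - {T}"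
  have A: "partition_on T A"
    unfolding A_def T_def using partition_on_remove_part fct P1 by blast
  have B: "partition_on S B"
    using partition_on_remove_part[OF fct[OF P2(1)] P2(2)] ST by (simp add: B_def)
  have "\<exists>P'. partition_on (E - {S, T}) P' \<and> (\<forall>F\<in>P'. partition_on V F)"
  proof (cases "P1 = P2")
    case True
    have "S \<noteq> T" using ST by (auto simp: T_def)
    then have "T \<in> A" using True P2 by (simp add: A_def)
    have "partition_on (T - T) (A - {T})"
      by (rule partition_on_remove_part[OF A \<open>T \<in> A\<close>])
    then have "A - {T} = {}" by (simp only: Diff_cancel partition_on_empty)
    then have "P1 = {S, T}" using P1 P2 True by (auto simp: A_def)
    then have "partition_on (E - {S, T}) (P - {P1})"
      using partition_on_remove_part[OF P P1(1)] by simp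
    then show ?thesis using fct by blast
  next
    case False
    define R where "R = P - {P1} - {P2}"
    have R: "partition_on (E - P1 - P2) R"
      unfolding R_def
      by (intro partition_on_remove_part P P1 P2) (use False P2 in auto)
    \<comment> \<open>The edges left over from the two broken 1-factors form a new one.\<close>
    have AB: "partition_on V (A \<union> B)"
    proof -
      have "partition_on (T \<union> S) (A \<union> B)"
        using A B by (auto simp: partition_on_def T_def intro!: disjoint_union)
      moreover have "T \<union> S = V" using ST by (auto simp: T_def)
      ultimately show ?thesis by simp
    qed
    have sub: "P1 \<subseteq> E" "P2 \<subseteq> E" using P P1 P2 by (auto simp: partition_on_def)
    have disj: "P1 \<inter> P2 = {}"
      using P P1 P2 False by (auto simp: partition_on_def disjoint_def)
    have "A \<union> B \<noteq> {}" using AB ST by (auto simp: partition_on_def)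
    moreover have "disjnt (A \<union> B) (\<Union>R)"
      using partition_onD1[OF R] by (auto simp: disjnt_def A_def B_def)
    moreover have "E - {S, T} - (A \<union> B) = E - P1 - P2"
      using P1 P2 by (auto simp: A_def B_def)
    moreover have "A \<union> B \<subseteq> E - {S, T}"
      using sub disj P1 P2 by (auto simp: A_def B_def)
    ultimately have "partition_on (E - {S, T}) (insert (A \<union> B) R)"
      using R by (simp add: partition_on_insert)
    moreover have "\<forall>F\<in>insert (A \<union> B) R. partition_on V F"
      using AB fct by (auto simp: R_def)
    ultimately show ?thesis by blast
  qed
  moreover have "hypergraph (V, E - {S, T})" using hyp by (simp add: hypergraph_def)
  ultimately show ?thesis by (simp add: one_factorable_iff_partition_on T_def)
qed

lemma one_factorable_insert_complementary_pair:
  assumes S: "S \<subseteq> V" "S \<noteq> {}" "S \<noteq> V" and new: "S \<notin> E" "V - S \<notin> E"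
  shows "one_factorable (V, insert S (insert (V - S) E)) \<longleftrightarrow> one_factorable (V, E)"
proof
  assume "one_factorable (V, insert S (insert (V - S) E))"
  from one_factorable_remove_complementary_pair[OF this, of S] show "one_factorable (V, E)"
    using new by (simp add: insert_Diff_if)
next
  assume "one_factorable (V, E)"
  then obtain P where P: "partition_on E P" "\<forall>F\<in>P. partition_on V F"
    and hyp: "hypergraph (V, E)"
    by (auto simp: one_factorable_iff_partition_on)
  have VS: "V - S \<noteq> {}" using S by auto
  have pair: "partition_on V {S, V - S}"
    using S VS by (auto simp: partition_on_def disjoint_def)
  have "disjnt {S, V - S} (\<Union>P)" "insert S (insert (V - S) E) - {S, V - S} = E"
    using partition_onD1[OF P(1)] new by (auto simp: disjnt_def)
  then have "partition_on (insert S (insert (V - S) E)) (insert {S, V - S} P)"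
    using P(1) by (simp add: partition_on_insert)
  moreover have "\<forall>F\<in>insert {S, V - S} P. partition_on V F" using P(2) pair by simp
  moreover have "hypergraph (V, insert S (insert (V - S) E))"
    using hyp S VS by (auto simp: hypergraph_def)
  ultimately show "one_factorable (V, insert S (insert (V - S) E))"
    by (auto simp only: one_factorable_iff_partition_on)
qed

text \<open>
  Closure under complements keeps the rest of \<open>D\<close> closed when one pair is taken away, so the pairs
  can be treated one at a time; excluding \<open>{}\<close> and \<open>V\<close> ensures that both members of a pair are
  non-empty, hence admissible edges.
\<close>

lemma one_factorable_Un_complement_closed:
  assumes "finite D" "D \<subseteq> Pow V - {{}, V}" "\<And>S. S \<in> D \<Longrightarrow> V - S \<in> D" "D \<inter> E = {}"
  shows "one_factorable (V, D \<union> E) \<longleftrightarrow> one_factorable (V, E)"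
  using assms
proof (induction D rule: finite_psubset_induct)
  case (psubset D)
  show ?case
  proof (cases "D = {}")
    case False
    then obtain S where S: "S \<in> D" by auto
    define D' where "D' = D - {S, V - S}"
    have in_V: "S \<subseteq> V" "S \<noteq> {}" "S \<noteq> V" "V - S \<in> D" using S psubset.prems by auto
    have D: "D \<union> E = insert S (insert (V - S) (D' \<union> E))"
      using S in_V by (auto simp: D'_def)
    have closed: "V - X \<in> D'" if "X \<in> D'" for X
    proof -
      have "X \<subseteq> V" "V - X \<in> D" "X \<noteq> S" "X \<noteq> V - S"
        using that psubset.prems by (auto simp: D'_def)
      moreover have "V - (V - X) = X" "V - (V - S) = S"
        using calculation(1) in_V by (simp_all add: double_diff)
      ultimately show ?thesis by (metis D'_def Diff_iff empty_iff insert_iff)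
    qed
    have "one_factorable (V, D \<union> E) \<longleftrightarrow> one_factorable (V, D' \<union> E)"
      unfolding D
      by (rule one_factorable_insert_complementary_pair)
        (use S in_V psubset.prems(3) in \<open>auto simp: D'_def\<close>)
    also have "\<dots> \<longleftrightarrow> one_factorable (V, E)"
      by (rule psubset.IH) (use S psubset.prems closed in \<open>auto simp: D'_def\<close>)
    finally show ?thesis .
  qed simp
qed

theorem theorem1p3:
  fixes n k :: nat
  assumes "0 < n" and "0 < k"
    and "real n / 2 \<le> real k" and "k \<le> n - 1"
  shows "one_factorable (complete_upto n k) \<longleftrightarrow> one_factorable (complete_upto n (n - k - 1))"
proof -
  define V where "V = {1..n}"
  define D where "D = {e. e \<subseteq> V \<and> n - k \<le> card e \<and> card e \<le> k}"
  define E where "E = {e. e \<subseteq> V \<and> e \<noteq> {} \<and> card e \<le> n - k - 1}"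
  have V: "finite V" "card V = n" by (auto simp: V_def)
  have k: "k < n" "n \<le> 2 * k" using assms by linarith+
  have "finite D" using V(1) by (auto simp: D_def intro: finite_subset[of _ "Pow V"])
  moreover have "D \<subseteq> Pow V - {{}, V}" using k V by (auto simp: D_def)
  moreover have "V - S \<in> D" if "S \<in> D" for S
    using that k V by (auto simp: D_def card_Diff_subset finite_subset)
  moreover have "D \<inter> E = {}" using k by (auto simp: D_def E_def)
  ultimately have "one_factorable (V, D \<union> E) \<longleftrightarrow> one_factorable (V, E)"
    by (rule one_factorable_Un_complement_closed)
  moreover have "complete_upto n k = (V, D \<union> E)"
    using k by (auto simp: complete_upto_def D_def E_def V_def)
  moreover have "complete_upto n (n - k - 1) = (V, E)"
    by (simp add: complete_upto_def E_def V_def)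
  ultimately show ?thesis by simp
qed

end
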